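(* Let $m,n\in\mathbb{N}$. Suppose that $F\colon\mathbb{R}^n\to\mathbb{C}^{m\times m}$ is locally bounded and conditionally positive semidefinite with $F(0)\le 0$. Then there exists $C>0$ such that $$\|F(x)\|_{\mathcal{B}(\mathbb{C}^m)}\le C\,[1+|x|^2],\quad x\in\mathbb{R}^n.$$
   Context: $\|\cdot\|_{\mathcal{B}(\mathbb{C}^m)}$ is the operator norm with respect to the Euclidean norm on $\mathbb{C}^m$. $F(0)\le 0$ means that the matrix $-F(0)$ is positive semidefinite. A self-adjoint matrix $A=A^*\in\mathbb{C}^{M\times M}$ is conditionally positive semidefinite if $\sum_{j,k}\overline{c_j}A_{j,k}c_k\ge 0$ for all $c\in\mathbb{C}^M$ with $\sum_{j=1}^M c_j=0$. A function $F\colon\mathbb{R}^n\to\mathbb{C}^{m\times m}$ is conditionally positive semidefinite if for all $N\in\mathbb{N}$ and $x_1,\dots,x_N\in\mathbb{R}^n$ the block matrix $\{F(x_p-x_q)\}_{1\le p,q\le N}\in\mathbb{C}^{mN\times mN}$ is conditionally positive semidefinite. *)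

theory Defs
  imports "HOL-Analysis.Analysis"
begin

text \<open>
  A complex matrix of size \<open>M\<close> is represented by an entry function \<open>A :: 'i \<Rightarrow> 'i \<Rightarrow> complex\<close> restricted
  to a finite index set \<open>I\<close> with \<open>M\<close> elements, so that the size of a block matrix can vary inside a
  formula. None of the notions below depends on an enumeration of \<open>I\<close>.
\<close>

definition self_adjoint_on :: "'i set \<Rightarrow> ('i \<Rightarrow> 'i \<Rightarrow> complex) \<Rightarrow> bool" where
  "self_adjoint_on I A \<longleftrightarrow> (\<forall>j\<in>I. \<forall>k\<in>I. A j k = cnj (A k j))"

definition psd_on :: "'i set \<Rightarrow> ('i \<Rightarrow> 'i \<Rightarrow> complex) \<Rightarrow> bool" where
  "psd_on I A \<longleftrightarrow> self_adjoint_on I A \<and>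
     (\<forall>c. (\<Sum>j\<in>I. \<Sum>k\<in>I. cnj (c j) * A j k * c k) \<in> \<real>\<^sub>\<ge>\<^sub>0)"

definition cond_psd_on :: "'i set \<Rightarrow> ('i \<Rightarrow> 'i \<Rightarrow> complex) \<Rightarrow> bool" where
  "cond_psd_on I A \<longleftrightarrow> self_adjoint_on I A \<and>
     (\<forall>c. (\<Sum>j\<in>I. c j) = 0 \<longrightarrow> (\<Sum>j\<in>I. \<Sum>k\<in>I. cnj (c j) * A j k * c k) \<in> \<real>\<^sub>\<ge>\<^sub>0)"

definition psd_matrix :: "complex^'m^'m \<Rightarrow> bool" where
  "psd_matrix A \<longleftrightarrow> psd_on UNIV (\<lambda>j k. A $ j $ k)"

text \<open>
  Rows and columns of the block matrix are indexed by pairs (block, position within the block).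
  The constraint in \<^const>\<open>cond_psd_on\<close> is thus that all scalar entries of \<open>c\<close> sum to zero, not
  that the vectors belonging to the single blocks do.
\<close>

definition block_matrix ::
    "(real^'n \<Rightarrow> complex^'m^'m) \<Rightarrow> (nat \<Rightarrow> real^'n) \<Rightarrow> nat \<times> 'm \<Rightarrow> nat \<times> 'm \<Rightarrow> complex" where
  "block_matrix F x = (\<lambda>(p, j) (q, k). F (x p - x q) $ j $ k)"

definition cond_psd_function :: "(real^'n \<Rightarrow> complex^'m^'m) \<Rightarrow> bool" where
  "cond_psd_function F \<longleftrightarrow>
     (\<forall>(N::nat) (x::nat \<Rightarrow> real^'n). cond_psd_on ({1..N} \<times> UNIV) (block_matrix F x))"

definition locally_bounded :: "('a::topological_space \<Rightarrow> 'b::metric_space) \<Rightarrow> bool" where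
  "locally_bounded F \<longleftrightarrow> (\<forall>x. \<exists>U. open U \<and> x \<in> U \<and> bounded (F ` U))"

text \<open>
  The norm on \<^typ>\<open>complex^'m\<close> is the Euclidean one, so \<^const>\<open>onorm\<close> of the matrix action is the
  operator norm; the norm of the type \<^typ>\<open>complex^'m^'m\<close> itself is the Frobenius norm.
\<close>

definition op_norm :: "complex^'m^'m \<Rightarrow> real" where
  "op_norm A = onorm (\<lambda>v. A *v v)"

end

theory Submission
  imports Defs
begin

text \<open>
  For fixed \<open>v\<close> the scalar function \<open>f x = v\<^sup>* F(x) v\<close> is again conditionally positive semidefinite
  with \<open>f 0 \<le> 0\<close>. Testing it at the points \<open>x, -x, 0\<close> with weights \<open>1, u, -(1 + u)\<close> for a suitable
  unimodular \<open>u\<close> yields \<open>|f(2x)| \<le> 4 |f(x)|\<close>. As \<open>f\<close> is bounded on the unit ball, this doubling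
  estimate forces quadratic growth, and polarization transfers it to the entries of \<open>F\<close>.
\<close>

text \<open>Finitely many of the neighbourhoods on which \<open>F\<close> is bounded cover
  \<open>K\<close>. Needed for the closed unit ball, the start of the doubling argument.\<close>

lemma locally_bounded_imp_bounded_image:
  assumes "locally_bounded F" "compact K"
  shows "bounded (F ` K)"
proof -
  obtain U where U: "\<And>x. open (U x) \<and> x \<in> U x \<and> bounded (F ` U x)"
    using assms(1) unfolding locally_bounded_def by metis
  obtain D where "D \<subseteq> K" "finite D" "K \<subseteq> (\<Union>x\<in>D. U x)"
    using compactE_image[OF assms(2), of K U] U by blast
  then have "F ` K \<subseteq> (\<Union>x\<in>D. F ` U x)" "bounded (\<Union>x\<in>D. F ` U x)"
    using U by (blast, intro bounded_UN) auto
  then show ?thesis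
    using bounded_subset by blast
qed

text \<open>Repeated halving brings \<open>x\<close> into the unit ball. Each halving costs a factor
  4, which is exactly the factor by which the squared norm shrinks.\<close>

lemma doubling_imp_quadratic_growth:
  fixes h :: "'a::real_normed_vector \<Rightarrow> real"
  assumes doubling: "\<And>x. h (2 *\<^sub>R x) \<le> 4 * h x"
    and bound: "\<And>x. norm x \<le> 1 \<Longrightarrow> h x \<le> M"
    and M: "0 \<le> M"
  shows "h x \<le> 4 * M * (1 + (norm x)\<^sup>2)"
proof -
  \<comment> \<open>The maximum, rather than a sum, makes the bound reproduce itself under doubling,
    so the constant does not grow with \<open>k\<close>.\<close>
  have *: "norm x \<le> 2 ^ k \<Longrightarrow> h x \<le> M * max 1 (4 * (norm x)\<^sup>2)" for k x
  proof (induction k arbitrary: x)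
    case 0
    then have "h x \<le> M * 1" using bound by simp
    also have "\<dots> \<le> M * max 1 (4 * (norm x)\<^sup>2)" using M by (intro mult_left_mono) auto
    finally show ?case .
  next
    case (Suc k)
    show ?case
    proof (cases "norm x \<le> 1")
      case True
      then have "h x \<le> M * 1" using bound by simp
      also have "\<dots> \<le> M * max 1 (4 * (norm x)\<^sup>2)" using M by (intro mult_left_mono) auto
      finally show ?thesis .
    next
      case False
      then have sq: "1 \<le> (norm x)\<^sup>2" by simp
      have half: "norm ((1/2) *\<^sub>R x) = norm x / 2" by simp
      have "h x \<le> 4 * h ((1/2) *\<^sub>R x)"
        using doubling[of "(1/2) *\<^sub>R x"] by simp
      also have "h ((1/2) *\<^sub>R x) \<le> M * max 1 (4 * (norm ((1/2) *\<^sub>R x))\<^sup>2)"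
        using Suc.prems half by (intro Suc.IH) simp
      \<comment> \<open>Outside the unit ball the half point has norm above 1/2, so the second
        argument of the maximum wins there, and again at \<open>x\<close> itself.\<close>
      also have "max 1 (4 * (norm ((1/2) *\<^sub>R x))\<^sup>2) = (norm x)\<^sup>2"
        using sq unfolding half by (simp add: power_divide)
      also have "4 * (M * (norm x)\<^sup>2) = M * max 1 (4 * (norm x)\<^sup>2)"
        using sq by simp
      finally show ?thesis by simp
    qed
  qed
  obtain k where "norm x < 2 ^ k"
    using real_arch_pow[of 2 "norm x"] by auto
  then have "h x \<le> M * max 1 (4 * (norm x)\<^sup>2)"
    using *[of x k] by simp
  also have "\<dots> \<le> M * (4 * (1 + (norm x)\<^sup>2))"
    using M by (intro mult_left_mono) auto
  finally show ?thesis by (simp add: mult_ac)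
qed

definition quad_form :: "complex^'m^'m \<Rightarrow> ('m \<Rightarrow> complex) \<Rightarrow> complex" where
  "quad_form A v = (\<Sum>j\<in>UNIV. \<Sum>k\<in>UNIV. cnj (v j) * A $ j $ k * v k)"

lemma norm_quad_form_le:
  fixes A :: "complex^'m^'m"
  shows   "norm (quad_form A v) \<le> norm A * (\<Sum>j\<in>UNIV. \<Sum>k\<in>UNIV. norm (v j) * norm (v k))"
proof -
  have "norm (quad_form A v) \<le> (\<Sum>j\<in>UNIV. \<Sum>k\<in>UNIV. norm (cnj (v j) * A $ j $ k * v k))"
    unfolding quad_form_def
    by (intro order.trans[OF norm_sum] sum_mono order.refl)
  also have "\<dots> \<le> (\<Sum>j\<in>UNIV. \<Sum>k\<in>UNIV. norm A * (norm (v j) * norm (v k)))"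
  proof (intro sum_mono)
    fix j k :: 'm
    have "norm (A $ j $ k) \<le> norm A"
      using Finite_Cartesian_Product.norm_nth_le[of A j] Finite_Cartesian_Product.norm_nth_le[of "A $ j" k] by linarith
    then have "norm (A $ j $ k) * (norm (v j) * norm (v k)) \<le> norm A * (norm (v j) * norm (v k))"
      by (intro mult_right_mono) auto
    then show "norm (cnj (v j) * A $ j $ k * v k) \<le> norm A * (norm (v j) * norm (v k))"
      by (simp add: norm_mult mult_ac)
  qed
  finally show ?thesis by (simp add: sum_distrib_left)
qed

text \<open>The test vector is e_j + u e_k. Written as a sum of two indicators, it also covers the
  case \<open>j = k\<close>.\<close>

lemma quad_form_two_point:
  "quad_form A (\<lambda>i. (if i = j then 1 else 0) + (if i = k then u else 0)) =
    A $ j $ j + u * A $ j $ k + cnj u * A $ k $ j + cnj u * u * A $ k $ k"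
proof -
  have 1: "(\<Sum>i\<in>UNIV. g i * ((if i = j then 1 else 0) + (if i = k then u else 0))) = g j + g k * u"
    for g :: "'a \<Rightarrow> complex"
    by (simp add: distrib_left sum.distrib if_distrib[of "\<lambda>z. _ * z"] cong: if_cong)
  have 2: "(\<Sum>i\<in>UNIV. cnj ((if i = j then 1 else 0) + (if i = k then u else 0)) * g i)
      = g j + cnj u * g k" for g :: "'a \<Rightarrow> complex"
    by (simp add: distrib_right sum.distrib if_distrib[of cnj] if_distrib[of "\<lambda>z. z * _"] cong: if_cong)
  show ?thesis
    unfolding quad_form_def 1 mult.assoc sum_distrib_left[symmetric] 2
    unfolding mult.assoc[symmetric] 1 by (simp add: algebra_simps)
qed

text \<open>Summing \<open>cnj u * q u j k\<close> over the fourth roots of unity \<open>u\<close>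
  cancels every term of the two-point expansion except the one with coefficient
  \<open>u\<close>.\<close>

lemma polarization_entry:
  fixes A :: "complex^'m^'m"
  defines "q u \<equiv> \<lambda>j k. quad_form A (\<lambda>i. (if i = j then 1 else 0) + (if i = k then u else 0))"
  shows "4 * A $ j $ k = q 1 j k - q (-1) j k - \<i> * q \<i> j k + \<i> * q (-\<i>) j k"
  unfolding q_def quad_form_two_point by (simp add: algebra_simps)

text \<open>Self-adjointness of the block matrix for the two points \<open>x\<close> and 0 relates
  F(-x) to the conjugate transpose of F(x).\<close>

lemma quad_form_minus_arg:
  assumes "cond_psd_function F"
  shows "quad_form (F (- x)) v = cnj (quad_form (F x) v)"
proof -
  define y :: "nat \<Rightarrow> _" where "y = (\<lambda>_. 0)(1 := x)"
  have "self_adjoint_on ({1..2} \<times> UNIV) (block_matrix F y)"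
    using assms unfolding cond_psd_function_def cond_psd_on_def by blast
  then have "block_matrix F y (2, j) (1, k) = cnj (block_matrix F y (1, k) (2, j))" for j k
    unfolding self_adjoint_on_def by (elim ballE[of _ _ "(2, j)"] ballE[of _ _ "(1, k)"]) auto
  then have entry: "F (- x) $ j $ k = cnj (F x $ k $ j)" for j k
    by (simp add: block_matrix_def y_def)
  have "quad_form (F (- x)) v = (\<Sum>j\<in>UNIV. \<Sum>k\<in>UNIV. cnj (cnj (v k) * F x $ k $ j * v j))"
    unfolding quad_form_def entry by (simp add: mult_ac)
  also have "\<dots> = cnj (quad_form (F x) v)"
    unfolding quad_form_def cnj_sum by (rule sum.swap)
  finally show ?thesis .
qed

text \<open>The coefficients \<open>a p * v j\<close> have total sum (sum of \<open>a\<close>) times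
  (sum of \<open>v\<close>), so the constraint on the scalar entries holds for arbitrary
  \<open>v\<close> once the weights \<open>a\<close> sum to zero.\<close>

lemma quad_form_cond_psd:
  fixes F :: "real^'n \<Rightarrow> complex^'m^'m" and x :: "nat \<Rightarrow> real^'n"
  assumes "cond_psd_function F" "(\<Sum>p\<in>{1..N}. a p) = 0"
  shows "(\<Sum>p\<in>{1..N}. \<Sum>q\<in>{1..N}. cnj (a p) * quad_form (F (x p - x q)) v * a q) \<in> \<real>\<^sub>\<ge>\<^sub>0"
proof -
  let ?I = "{1..N} \<times> UNIV" and ?c = "\<lambda>(p, j). a p * v j"
  have "(\<Sum>i\<in>?I. ?c i) = (\<Sum>p\<in>{1..N}. a p) * (\<Sum>j\<in>UNIV. v j)"
    by (simp add: sum.cartesian_product[symmetric] sum_product)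
  also have "\<dots> = 0" unfolding assms(2) by simp
  finally have "(\<Sum>i\<in>?I. \<Sum>l\<in>?I. cnj (?c i) * block_matrix F x i l * ?c l) \<in> \<real>\<^sub>\<ge>\<^sub>0"
    using assms(1) unfolding cond_psd_function_def cond_psd_on_def by blast
  also have "(\<Sum>i\<in>?I. \<Sum>l\<in>?I. cnj (?c i) * block_matrix F x i l * ?c l) =
      (\<Sum>p\<in>{1..N}. \<Sum>j\<in>UNIV. \<Sum>q\<in>{1..N}. \<Sum>k\<in>UNIV.
        cnj (a p * v j) * F (x p - x q) $ j $ k * (a q * v k))"
    by (simp add: sum.cartesian_product' block_matrix_def)
  also have "\<dots> = (\<Sum>p\<in>{1..N}. \<Sum>q\<in>{1..N}. \<Sum>j\<in>UNIV. \<Sum>k\<in>UNIV.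
        cnj (a p * v j) * F (x p - x q) $ j $ k * (a q * v k))"
    by (intro sum.cong refl sum.swap)
  also have "\<dots> = (\<Sum>p\<in>{1..N}. \<Sum>q\<in>{1..N}. cnj (a p) * quad_form (F (x p - x q)) v * a q)"
    unfolding quad_form_def by (simp add: sum_distrib_left sum_distrib_right mult_ac)
  finally show ?thesis .
qed

lemma quad_form_doubling:
  assumes F: "cond_psd_function F" and F0: "psd_matrix (- F 0)"
  shows "norm (quad_form (F (2 *\<^sub>R x)) v) \<le> 4 * norm (quad_form (F x) v)"
proof (cases "quad_form (F (2 *\<^sub>R x)) v = 0")
  case False
  define f where "f = (\<lambda>y. quad_form (F y) v)"
  \<comment> \<open>The phase is chosen to make \<open>u * f (2 *\<^sub>R x)\<close> equal to minus
    the norm of \<open>f (2 *\<^sub>R x)\<close>; this is why the vanishing case was split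
    off.\<close>
  define u where "u = - cnj (f (2 *\<^sub>R x)) / norm (f (2 *\<^sub>R x))"
  \<comment> \<open>Index 3 takes the default values: the point 0 with the weight that makes the sum
    vanish.\<close>
  define a :: "nat \<Rightarrow> complex" where "a = (\<lambda>_. - (1 + u))(1 := 1, 2 := u)"
  define y :: "nat \<Rightarrow> _" where "y = (\<lambda>_. 0)(1 := x, 2 := - x)"
  have nz: "f (2 *\<^sub>R x) \<noteq> 0" using False by (simp add: f_def)
  have u: "norm u = 1" using nz by (simp add: u_def norm_divide)
  have uf: "u * f (2 *\<^sub>R x) = - norm (f (2 *\<^sub>R x))"
    using nz by (simp add: u_def mult.commute[of "cnj _"] complex_norm_square[symmetric] power2_eq_square)
  have minus: "f (- z) = cnj (f z)" for z
    unfolding f_def by (rule quad_form_minus_arg[OF F])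
  have "- f 0 \<in> \<real>\<^sub>\<ge>\<^sub>0"
    using F0 unfolding psd_matrix_def psd_on_def f_def quad_form_def by (simp add: sum_negf)
  then have f0: "Re (f 0) \<le> 0" by (simp add: complex_nonneg_Reals_iff)
  have I: "{1..3::nat} = {1, 2, 3}" by auto
  have "(\<Sum>p\<in>{1..3}. a p) = 0" unfolding I by (simp add: a_def)
  from quad_form_cond_psd[OF F this, of y v]
  have "0 \<le> Re (\<Sum>p\<in>{1..3}. \<Sum>q\<in>{1..3}. cnj (a p) * f (y p - y q) * a q)"
    unfolding f_def by (simp only: complex_nonneg_Reals_iff)
  \<comment> \<open>The diagonal gives the multiple of \<open>f 0\<close>, and the pair
    \<open>x\<close>, \<open>- x\<close> gives the terms at 2x. As \<open>u\<close> is unimodular,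
    \<open>cnj u * (1 + u) = 1 + cnj u\<close>, so the pairs \<open>x\<close>, 0 and
    \<open>- x\<close>, 0 contribute equally; hence the factor 2.\<close>
  also have "(\<Sum>p\<in>{1..3}. \<Sum>q\<in>{1..3}. cnj (a p) * f (y p - y q) * a q) =
      (1 + cnj u * u + cnj (1 + u) * (1 + u)) * f 0
      + (u * f (2 *\<^sub>R x) + cnj (u * f (2 *\<^sub>R x)))
      - 2 * ((1 + u) * f x + cnj ((1 + u) * f x))"
  proof -
    have d: "- x - x = - (2 *\<^sub>R x)" by (simp add: scaleR_2)
    have uu: "u * (cnj u * z) = z" for z
      using u by (simp add: mult.assoc[symmetric] complex_norm_square[symmetric])
    show ?thesis
      unfolding I by (simp add: a_def y_def d minus scaleR_2[symmetric]) (simp add: algebra_simps uu)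
  qed
  finally have "0 \<le> (2 + (norm (1 + u))\<^sup>2) * Re (f 0) - 2 * norm (f (2 *\<^sub>R x)) - 4 * Re ((1 + u) * f x)"
    unfolding uf using u
    by (simp add: mult.commute[of "cnj _"] complex_norm_square[symmetric] mult.commute[of "Re (f x)"]
        del: complex_cnj_mult complex_cnj_add)
  moreover have "(2 + (norm (1 + u))\<^sup>2) * Re (f 0) \<le> 0"
    using f0 by (intro mult_nonneg_nonpos) auto
  \<comment> \<open>With the \<open>f 0\<close> term being nonpositive, this turns the inequality
    into 2 |f(2x)| \<le> 8 |f(x)|.\<close>
  moreover have "- Re ((1 + u) * f x) \<le> 2 * norm (f x)"
  proof -
    have "- Re ((1 + u) * f x) \<le> norm (1 + u) * norm (f x)"
      using abs_Re_le_cmod[of "(1 + u) * f x"] unfolding norm_mult by linarith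
    also have "\<dots> \<le> 2 * norm (f x)"
      using norm_triangle_ineq[of 1 u] u by (intro mult_right_mono) auto
    finally show ?thesis .
  qed
  ultimately show ?thesis unfolding f_def by linarith
qed simp

text \<open>The growth constant of the quadratic form depends on \<open>v\<close>. This is harmless,
  since polarization recovers a fixed entry from only four vectors.\<close>

lemma entry_quadratic_growth:
  fixes F :: "real^'n \<Rightarrow> complex^'m^'m"
  assumes lb: "locally_bounded F" and F: "cond_psd_function F" and F0: "psd_matrix (- F 0)"
  shows "\<exists>C\<ge>0. \<forall>x. norm (F x $ j $ k) \<le> C * (1 + (norm x)\<^sup>2)"
proof -
  obtain B where B: "\<And>x. norm x \<le> 1 \<Longrightarrow> norm (F x) \<le> B"
    using locally_bounded_imp_bounded_image[OF lb compact_cball[of 0 1]]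
    unfolding bounded_iff by (metis image_eqI mem_cball_0)
  have "\<exists>C\<ge>0. \<forall>x. norm (quad_form (F x) v) \<le> C * (1 + (norm x)\<^sup>2)" for v
  proof -
    define S where "S = (\<Sum>j\<in>UNIV. \<Sum>k\<in>UNIV. norm (v j) * norm (v k))"
    have S: "0 \<le> S" unfolding S_def by (intro sum_nonneg) auto
    have B0: "0 \<le> B" using B[of 0] norm_ge_zero[of "F 0"] by (simp del: norm_ge_zero)
    have "norm (quad_form (F x) v) \<le> 4 * (B * S) * (1 + (norm x)\<^sup>2)" for x
    proof (rule doubling_imp_quadratic_growth)
      show "norm (quad_form (F y) v) \<le> B * S" if "norm y \<le> 1" for y
        using norm_quad_form_le[of "F y" v] mult_right_mono[OF B[OF that] S] unfolding S_def by linarith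
    qed (use quad_form_doubling[OF F F0] B0 S in auto)
    then show ?thesis using B0 S by (intro exI[of _ "4 * (B * S)"]) auto
  qed
  then obtain C where C: "\<And>v. 0 \<le> C v"
      "\<And>v x. norm (quad_form (F x) v) \<le> C v * (1 + (norm x)\<^sup>2)"
    by metis
  define w where "w = (\<lambda>u i. (if i = j then 1 else 0) + (if i = k then u else 0 :: complex))"
  have "norm (F x $ j $ k) \<le> (C (w 1) + C (w (-1)) + C (w \<i>) + C (w (-\<i>))) * (1 + (norm x)\<^sup>2)" for x
  proof -
    let ?q = "\<lambda>u. quad_form (F x) (w u)"
    have "4 * norm (F x $ j $ k) = norm (4 * F x $ j $ k)" by (simp add: norm_mult)
    also have "\<dots> = norm (?q 1 - ?q (-1) - \<i> * ?q \<i> + \<i> * ?q (-\<i>))"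
      unfolding polarization_entry w_def ..
    also have "\<dots> \<le> norm (?q 1) + norm (?q (-1)) + norm (\<i> * ?q \<i>) + norm (\<i> * ?q (-\<i>))"
      by (intro order.trans[OF norm_triangle_ineq] order.trans[OF norm_triangle_ineq4] add_mono order.refl)
    also have "\<dots> = norm (?q 1) + norm (?q (-1)) + norm (?q \<i>) + norm (?q (-\<i>))"
      by (simp add: norm_mult)
    also have "\<dots> \<le> (C (w 1) + C (w (-1)) + C (w \<i>) + C (w (-\<i>))) * (1 + (norm x)\<^sup>2)"
      unfolding distrib_right by (intro add_mono C)
    \<comment> \<open>The factor 4 from polarization is simply discarded.\<close>
    finally show ?thesis using norm_ge_zero[of "F x $ j $ k"] by linarith
  qed
  then show ?thesis using C(1) by (meson add_nonneg_nonneg)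
qed

text \<open>The Euclidean norm of the image is at most the sum of the moduli of its components, and
  each component of \<open>v\<close> is at most \<open>norm v\<close>. A crude bound suffices, as
  \<open>C\<close> may depend on the dimension.\<close>

lemma op_norm_le_sum_entries: "op_norm A \<le> (\<Sum>j\<in>UNIV. \<Sum>k\<in>UNIV. norm (A $ j $ k))"
  unfolding op_norm_def
proof (rule onorm_le)
  fix v
  have "norm (A *v v) \<le> (\<Sum>j\<in>UNIV. norm ((A *v v) $ j))"
    unfolding norm_vec_def by (rule L2_set_le_sum) simp
  also have "\<dots> \<le> (\<Sum>j\<in>UNIV. \<Sum>k\<in>UNIV. norm (A $ j $ k * v $ k))"
    unfolding matrix_vector_mult_def by (simp add: norm_sum sum_mono)
  also have "\<dots> \<le> (\<Sum>j\<in>UNIV. \<Sum>k\<in>UNIV. norm (A $ j $ k) * norm v)"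
    unfolding norm_mult by (intro sum_mono mult_left_mono Finite_Cartesian_Product.norm_nth_le norm_ge_zero)
  finally show "norm (A *v v) \<le> (\<Sum>j\<in>UNIV. \<Sum>k\<in>UNIV. norm (A $ j $ k)) * norm v"
    by (simp add: sum_distrib_right)
qed

theorem theorem4p18:
  fixes F :: "real^'n \<Rightarrow> complex^'m^'m"
  assumes "locally_bounded F"
    and "cond_psd_function F"
    and "psd_matrix (- F 0)"
  shows "\<exists>C>0. \<forall>x. op_norm (F x) \<le> C * (1 + (norm x)\<^sup>2)"
proof -
  obtain C where C: "\<And>j k. 0 \<le> C j k"
      "\<And>j k x. norm (F x $ j $ k) \<le> C j k * (1 + (norm x)\<^sup>2)"
    using entry_quadratic_growth[OF assms] by metis
  define D where "D = (\<Sum>j\<in>UNIV. \<Sum>k\<in>UNIV. C j k)"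
  have D: "0 \<le> D" unfolding D_def by (intro sum_nonneg C)
  \<comment> \<open>The added 1 makes the constant strictly positive even if \<open>D\<close> is
    0.\<close>
  have "op_norm (F x) \<le> (D + 1) * (1 + (norm x)\<^sup>2)" for x
  proof -
    have "op_norm (F x) \<le> (\<Sum>j\<in>UNIV. \<Sum>k\<in>UNIV. C j k * (1 + (norm x)\<^sup>2))"
      by (intro order.trans[OF op_norm_le_sum_entries] sum_mono C)
    also have "\<dots> = D * (1 + (norm x)\<^sup>2)"
      unfolding D_def by (simp only: sum_distrib_right)
    also have "\<dots> \<le> (D + 1) * (1 + (norm x)\<^sup>2)"
      by (intro mult_right_mono) auto
    finally show ?thesis .
  qed
  then show ?thesis using D by (intro exI[of _ "D + 1"]) auto
qed

end
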